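(* Let $b,c>0$ be real numbers and let $T_n(b,c)$ be the coefficient of $x^n$ in the expansion of $(x^2+bx+c)^n$. (i) The sequence $(T_n(b,c))_{n\ge 0}$ is log-convex if and only if $b^2\ge 2c$. (ii) The sequence $(T_n(b,c))_{n\ge 0}$ is a Stieltjes moment sequence if and only if $b^2\ge 4c$.
   Context: A sequence $(a_k)_{k\ge 0}$ of nonnegative numbers is log-convex if $a_ia_{j+1}\ge a_{i+1}a_j$ for all $0\le i<j$. It is a Stieltjes moment sequence if there exists a nonnegative Borel measure $\mu$ on $[0,+\infty)$ such that $a_k=\int_0^{+\infty}x^k\,d\mu(x)$ for all $k\ge 0$. *)

theory Defs
  imports "HOL-Analysis.Analysis" "HOL-Computational_Algebra.Polynomial"
begin

definition central_trinomial :: "real \<Rightarrow> real \<Rightarrow> nat \<Rightarrow> real" where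
  "central_trinomial b c n = coeff ([:c, b, 1:] ^ n) n"

definition log_convex_seq :: "(nat \<Rightarrow> real) \<Rightarrow> bool" where
  "log_convex_seq a \<longleftrightarrow>
     (\<forall>k. 0 \<le> a k) \<and> (\<forall>i j. i < j \<longrightarrow> a i * a (j + 1) \<ge> a (i + 1) * a j)"

text \<open>
  Stating the moments with \<^const>\<open>has_bochner_integral\<close> makes every moment integrable, so that a
  divergent moment is not read as \<open>0\<close>. Nonnegativity of the sequence is then automatic.
\<close>
definition stieltjes_moment_seq :: "(nat \<Rightarrow> real) \<Rightarrow> bool" where
  "stieltjes_moment_seq a \<longleftrightarrow>
     (\<exists>M :: real measure. sets M = sets (restrict_space borel {0..}) \<and>
        (\<forall>k. has_bochner_integral M (\<lambda>x. x ^ k) (a k)))"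

end

theory Submission
  imports Defs
begin

text \<open>
  The number \<open>T n = central_trinomial b c n\<close> is the mean of \<open>(b + 2 * sqrt c * cos \<theta>) ^ n\<close>,
  so \<open>T\<close> is a Stieltjes moment sequence if \<open>b \<ge> 2 * sqrt c\<close>. For the converse, the binomial
  transform of \<open>T\<close> is again a central trinomial sequence with shifted \<open>b\<close>; hence the integrals
  of \<open>(x - b - 2 * sqrt c) ^ n\<close> against any representing measure are explicit, and nonnegativity
  of those of \<open>x * (x - b - 2 * sqrt c) ^ (2 * n)\<close> forces \<open>b \<ge> 2 * sqrt c\<close>.

  Log-convexity fails at \<open>T 1 * T 3 \<ge> (T 2)\<^sup>2\<close> unless \<open>b\<^sup>2 \<ge> 2 * c\<close>. It follows from the
  Cauchy-Schwarz inequality if \<open>b\<^sup>2 \<ge> 4 * c\<close>. In the remaining range the ratios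
  \<open>T (n + 1) / T n\<close> satisfy a recurrence that is antitone in the previous ratio, and they interlace
  with the fixed points of its successive steps.
\<close>

section \<open>Recurrence for central trinomial coefficients\<close>

lemma central_trinomial_0 [simp]: "central_trinomial b c 0 = 1"
  by (simp add: central_trinomial_def)

lemma coeff_trinomial_power_Suc:
  fixes b c :: "'a::comm_ring_1"
  shows "coeff ([:c, b, 1:] ^ Suc n) (Suc (Suc k)) =
    c * coeff ([:c, b, 1:] ^ n) (Suc (Suc k)) + b * coeff ([:c, b, 1:] ^ n) (Suc k)
      + coeff ([:c, b, 1:] ^ n) k"
  by simp

text \<open>Coefficient comparison in \<open>(P ^ (n + 1))' = (n + 1) * P' * P ^ n\<close>, where
  \<open>P' = b + 2 * x\<close>.\<close>

lemma Suc_coeff_trinomial_power_Suc: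
  fixes b c :: real
  shows "real (Suc k) * coeff ([:c, b, 1:] ^ Suc n) (Suc k) =
    real (Suc n) * (b * coeff ([:c, b, 1:] ^ n) k +
      2 * (case k of 0 \<Rightarrow> 0 | Suc j \<Rightarrow> coeff ([:c, b, 1:] ^ n) j))"
proof -
  have "real (Suc k) * coeff ([:c, b, 1:] ^ Suc n) (Suc k) = coeff (pderiv ([:c, b, 1:] ^ Suc n)) k"
    by (simp add: coeff_pderiv del: power_Suc)
  also have "\<dots> = coeff (smult (real (Suc n)) (pderiv [:c, b, 1:] * [:c, b, 1:] ^ n)) k"
    by (simp add: pderiv_power_Suc mult.commute del: power_Suc)
  finally show ?thesis
    by (simp add: pderiv_pCons algebra_simps split: nat.splits del: power_Suc)
qed

text \<open>Expanding the product and differentiating give two formulas for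
  \<open>T (n + 1)\<close>; comparing them eliminates the coefficient just below the centre.\<close>

lemma central_trinomial_Suc:
  "central_trinomial b c (Suc n) =
    b * central_trinomial b c n + 2 * c * coeff ([:c, b, 1:] ^ n) (Suc n)"
proof (cases n)
  case 0
  then show ?thesis by (simp add: central_trinomial_def)
next
  case (Suc m)
  define T where "T = central_trinomial b c"
  define U where "U = coeff ([:c, b, 1:] ^ n) m"
  define V where "V = coeff ([:c, b, 1:] ^ n) (Suc n)"
  have "T (Suc n) = c * V + b * T n + U"
    using coeff_trinomial_power_Suc[of c b n m]
    by (simp add: T_def U_def V_def central_trinomial_def Suc del: power_Suc)
  moreover have "real (Suc n) * T (Suc n) = real (Suc n) * (b * T n + 2 * U)"
    using Suc_coeff_trinomial_power_Suc[of n c b n]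
    by (simp add: T_def U_def central_trinomial_def Suc del: power_Suc)
  then have "T (Suc n) = b * T n + 2 * U"
    by (simp del: of_nat_Suc)
  ultimately show ?thesis
    by (simp add: T_def V_def)
qed

lemma Suc_Suc_coeff_trinomial_power:
  "real (Suc (Suc n)) * coeff ([:c, b, 1:] ^ Suc n) (Suc (Suc n)) =
    real (Suc n) * (b * coeff ([:c, b, 1:] ^ n) (Suc n) + 2 * central_trinomial b c n)"
  using Suc_coeff_trinomial_power_Suc[of "Suc n" c b n]
  by (simp add: central_trinomial_def del: power_Suc)

text \<open>The central coefficient and its right neighbour \<open>V\<close> satisfy a first-order
  linear system; eliminating \<open>V\<close> leaves three consecutive \<open>T\<close>.\<close>

lemma central_trinomial_recurrence:
  "real (n + 2) * central_trinomial b c (n + 2) =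
    real (2 * n + 3) * b * central_trinomial b c (n + 1)
      + real (n + 1) * (4 * c - b\<^sup>2) * central_trinomial b c n"
proof -
  define T where "T = central_trinomial b c"
  define V where "V n = coeff ([:c, b, 1:] ^ n) (Suc n)" for n
  have T: "T (Suc n) = b * T n + 2 * c * V n" for n
    by (simp add: T_def V_def central_trinomial_Suc)
  have V: "(real n + 2) * V (Suc n) = (real n + 1) * (b * V n + 2 * T n)"
    using Suc_Suc_coeff_trinomial_power[of n c b] by (simp add: T_def V_def add.commute)
  have "(real n + 2) * T (Suc (Suc n)) = (real n + 2) * b * T (Suc n) + 2 * c * ((real n + 2) * V (Suc n))"
    by (subst T) (simp add: algebra_simps)
  also have "\<dots> = (real n + 2) * b * T (Suc n) + (real n + 1) * (b * (2 * c * V n) + 4 * c * T n)"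
    unfolding V by (simp add: algebra_simps)
  also have "2 * c * V n = T (Suc n) - b * T n"
    by (simp add: T)
  finally show ?thesis
    by (simp add: T_def algebra_simps power2_eq_square)
qed

section \<open>Small values, positivity and change of \<open>b\<close>\<close>

lemma central_trinomial_1: "central_trinomial b c (Suc 0) = b"
  by (simp add: central_trinomial_def)

lemma central_trinomial_2: "central_trinomial b c 2 = b\<^sup>2 + 2 * c"
  using central_trinomial_recurrence[of 0 b c]
  by (simp add: numeral_2_eq_2 central_trinomial_1 power2_eq_square)

lemma central_trinomial_3: "central_trinomial b c 3 = b ^ 3 + 6 * b * c"
  using central_trinomial_recurrence[of 1 b c]
  by (simp add: numeral_3_eq_3 central_trinomial_1 central_trinomial_2[unfolded numeral_2_eq_2]
      algebra_simps power2_eq_square)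

lemma central_trinomial_pos:
  assumes "b > 0" "c > 0"
  shows "central_trinomial b c n > 0"
proof -
  \<comment> \<open>The induction must carry the neighbouring coefficient, which is only nonnegative
    because it vanishes at \<open>n = 0\<close>.\<close>
  have "central_trinomial b c n > 0 \<and> coeff ([:c, b, 1:] ^ n) (Suc n) \<ge> 0"
  proof (induction n)
    case 0
    then show ?case by simp
  next
    case (Suc n)
    have "real (Suc (Suc n)) * coeff ([:c, b, 1:] ^ Suc n) (Suc (Suc n)) \<ge> 0"
      unfolding Suc_Suc_coeff_trinomial_power using Suc assms by simp
    then have "coeff ([:c, b, 1:] ^ Suc n) (Suc (Suc n)) \<ge> 0"
      by (simp add: zero_le_mult_iff del: power_Suc)
    then show ?case
      using Suc assms by (simp add: central_trinomial_Suc add_pos_nonneg del: power_Suc)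
  qed
  then show ?thesis ..
qed

text \<open>Binomial expansion of \<open>(P + d * x) ^ n\<close>: the factor
  \<open>x ^ (n - k)\<close> turns coefficient \<open>n\<close> into the central coefficient of
  \<open>P ^ k\<close>.\<close>

lemma central_trinomial_add:
  "central_trinomial (b + d) c n =
    (\<Sum>k\<le>n. real (n choose k) * central_trinomial b c k * d ^ (n - k))"
proof -
  have "[:c, b + d, 1:] ^ n = ([:c, b, 1:] + monom d 1) ^ n"
    by (simp add: monom_altdef)
  also have "\<dots> = (\<Sum>k\<le>n. monom (real (n choose k) * d ^ (n - k)) (n - k) * [:c, b, 1:] ^ k)"
    unfolding binomial_ring
    by (intro sum.cong refl) (simp add: monom_power of_nat_monom mult_monom flip: mult.assoc)
  finally have "central_trinomial (b + d) c n =
      (\<Sum>k\<le>n. coeff (monom (real (n choose k) * d ^ (n - k)) (n - k) * [:c, b, 1:] ^ k) n)"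
    by (simp only: central_trinomial_def coeff_sum)
  also have "\<dots> = (\<Sum>k\<le>n. real (n choose k) * central_trinomial b c k * d ^ (n - k))"
    by (intro sum.cong refl) (auto simp: coeff_monom_mult central_trinomial_def)
  finally show ?thesis .
qed

lemma central_trinomial_zero_discriminant:
  assumes "b\<^sup>2 = 4 * c"
  shows "real (n + 1) * central_trinomial b c (n + 1) = real (2 * n + 1) * b * central_trinomial b c n"
proof (cases n)
  case 0
  then show ?thesis by (simp add: central_trinomial_1)
next
  case (Suc m)
  then show ?thesis
    using central_trinomial_recurrence[of m b c] assms by (simp add: algebra_simps)
qed

section \<open>Stieltjes moment sequences\<close>

text \<open>The function \<open>f\<close> is kept general to cover both the cosine on the unit
  interval and the identity under a representing measure.\<close>

lemma has_bochner_integral_shifted_moment: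
  fixes M :: "real measure"
  assumes "\<And>k. has_bochner_integral M (\<lambda>x. f x ^ k) (central_trinomial b c k)"
  shows "has_bochner_integral M (\<lambda>x. (f x + d) ^ n) (central_trinomial (b + d) c n)"
proof -
  have "has_bochner_integral M (\<lambda>x. \<Sum>k\<le>n. real (n choose k) * f x ^ k * d ^ (n - k))
    (central_trinomial (b + d) c n)"
    unfolding central_trinomial_add
    by (intro has_bochner_integral_sum has_bochner_integral_mult_left has_bochner_integral_mult_right assms)
  then show ?thesis
    by (simp add: binomial_ring)
qed

text \<open>For \<open>b = 0\<close> the recurrence links only \<open>n\<close> and
  \<open>n + 2\<close>; integration by parts yields the same relation for the cosine
  integrals.\<close>

lemma has_bochner_integral_cos_moment:
  assumes "c \<ge> 0"
  shows "has_bochner_integral (restrict_space lborel {0..1})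
    (\<lambda>t. (2 * sqrt c * cos (pi * t)) ^ n) (central_trinomial 0 c n)"
proof -
  define M :: "real measure" where "M = restrict_space lborel {0..1}"
  have FTC: "has_bochner_integral M f (F 1 - F 0)"
    if "\<And>t. (F has_real_derivative f t) (at t)" "\<And>t. isCont f t" for f F :: "real \<Rightarrow> real"
    unfolding M_def using has_bochner_integral_FTC_Icc_real[of 0 1 F f] that
    by (simp add: has_bochner_integral_restrict_space mult.commute)
  define a where "a = 2 * sqrt c"
  have a2: "a\<^sup>2 = 4 * c"
    using assms by (simp add: a_def power2_eq_square)
  have "has_bochner_integral M (\<lambda>t. (a * cos (pi * t)) ^ n) (central_trinomial 0 c n)"
  proof (induction n rule: induct_nat_012)
    case 0
    then show ?case
      using FTC[of "\<lambda>t. t" "\<lambda>_. 1"] by simp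
  next
    case 1
    have "has_bochner_integral M (\<lambda>t. a * cos (pi * t)) (a * sin (pi * 1) / pi - a * sin (pi * 0) / pi)"
      by (rule FTC[of "\<lambda>t. a * sin (pi * t) / pi"])
        (auto intro!: derivative_eq_intros continuous_intros)
    then show ?case
      by (simp add: central_trinomial_1)
  next
    case (ge2 n)
    \<comment> \<open>\<open>f\<close> is the derivative of \<open>F\<close>, and the sine factor
      makes \<open>F\<close> vanish at both ends, so \<open>f\<close> integrates to 0.\<close>
    define f where "f t = a ^ (n + 2) * (real (n + 2) * cos (pi * t) ^ (n + 2)
      - real (n + 1) * cos (pi * t) ^ n)" for t
    define F where "F t = a ^ (n + 2) * (sin (pi * t) * cos (pi * t) ^ (n + 1) / pi)" for t
    have "(F has_real_derivative f t) (at t)" for t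
    proof -
      define s d where "s = sin (pi * t)" and "d = cos (pi * t)"
      have sd: "s * s = 1 - d * d"
        using sin_cos_squared_add[of "pi * t"] by (simp add: s_def d_def power2_eq_square)
      have "(F has_real_derivative a ^ (n + 2) * (d * d ^ (n + 1) - real (n + 1) * d ^ n * (s * s))) (at t)"
        unfolding F_def s_def d_def
        by (rule derivative_eq_intros refl | simp add: field_simps)+
      then show ?thesis
        by (simp add: sd f_def d_def algebra_simps power2_eq_square)
    qed
    moreover have "isCont f t" for t
      unfolding f_def by (intro continuous_intros)
    ultimately have "has_bochner_integral M f (F 1 - F 0)"
      by (rule FTC)
    then have "has_bochner_integral M f 0"
      by (simp add: F_def)
    from has_bochner_integral_add[OF this has_bochner_integral_mult_right[OF ge2(1), of "a\<^sup>2 * real (n + 1)"]]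
    have "has_bochner_integral M (\<lambda>t. f t + a\<^sup>2 * real (n + 1) * (a * cos (pi * t)) ^ n)
      (a\<^sup>2 * real (n + 1) * central_trinomial 0 c n)"
      by simp
    also have "(\<lambda>t. f t + a\<^sup>2 * real (n + 1) * (a * cos (pi * t)) ^ n) =
      (\<lambda>t. real (n + 2) * (a * cos (pi * t)) ^ (n + 2))"
      by (rule ext) (simp add: f_def algebra_simps power_mult_distrib power_add power2_eq_square)
    also have "a\<^sup>2 * real (n + 1) * central_trinomial 0 c n =
      real (n + 2) * central_trinomial 0 c (n + 2)"
      using central_trinomial_recurrence[of n 0 c] by (simp add: a2)
    finally have "has_bochner_integral M (\<lambda>t. real (n + 2) * (a * cos (pi * t)) ^ (n + 2))
      (real (n + 2) * central_trinomial 0 c (n + 2))" .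
    from has_bochner_integral_mult_right[OF this, of "1 / real (n + 2)"]
    show ?case
      by (simp del: of_nat_add of_nat_Suc power_Suc)
  qed
  then show ?thesis
    by (simp add: M_def a_def)
qed

text \<open>The representing measure is the image of Lebesgue measure on the unit interval; the
  bound on \<open>b\<close> keeps it on the half-line.\<close>

lemma stieltjes_moment_seq_central_trinomial:
  assumes "c \<ge> 0" "b \<ge> 2 * sqrt c"
  shows "stieltjes_moment_seq (central_trinomial b c)"
  unfolding stieltjes_moment_seq_def
proof (intro exI conjI allI)
  let ?M = "restrict_space lborel {0..1::real}"
  let ?g = "\<lambda>t. 2 * sqrt c * cos (pi * t) + b"
  let ?N = "restrict_space borel {0::real..}"
  show "sets (distr ?M ?N ?g) = sets ?N"
    by simp
  have nonneg: "?g t \<ge> 0" for t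
  proof -
    have "2 * sqrt c * (-1) \<le> 2 * sqrt c * cos (pi * t)"
      using assms(1) by (intro mult_left_mono) auto
    then show ?thesis using assms(2) by simp
  qed
  have meas: "?g \<in> measurable ?M ?N"
    by (rule measurable_restrict_space2)
      (use nonneg in \<open>auto intro!: measurable_restrict_space1\<close>)
  show "has_bochner_integral (distr ?M ?N ?g) (\<lambda>x. x ^ k) (central_trinomial b c k)" for k
    by (rule has_bochner_integral_distr[OF _ meas])
      (use has_bochner_integral_shifted_moment[OF has_bochner_integral_cos_moment[OF assms(1)], of b k]
        in \<open>auto intro!: measurable_restrict_space1\<close>)
qed

section \<open>Consequences of being a Stieltjes moment sequence\<close>

lemma has_bochner_integral_nonneg_halfline:
  fixes M :: "real measure" and f :: "real \<Rightarrow> real"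
  assumes "sets M = sets (restrict_space borel {0..})"
    and "has_bochner_integral M f I"
    and "\<And>x. x \<ge> 0 \<Longrightarrow> f x \<ge> 0"
  shows "I \<ge> 0"
proof -
  have "space M = {0..}"
    using sets_eq_imp_space_eq[OF assms(1)] by (simp add: space_restrict_space)
  then have "integral\<^sup>L M f \<ge> 0"
    using assms(3) by (intro Bochner_Integration.integral_nonneg) auto
  then show ?thesis
    using assms(2) has_bochner_integral_integral_eq by blast
qed

text \<open>Cauchy-Schwarz, obtained by integrating
  \<open>x ^ n * (a n * x - a (n + 1))\<^sup>2\<close> and dividing by \<open>a n\<close>.\<close>

lemma stieltjes_moment_seq_turan:
  assumes "stieltjes_moment_seq a" "a n > 0"
  shows "(a (n + 1))\<^sup>2 \<le> a n * a (n + 2)"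
proof -
  obtain M :: "real measure" where M: "sets M = sets (restrict_space borel {0..})"
    and mom: "\<And>k. has_bochner_integral M (\<lambda>x. x ^ k) (a k)"
    using assms(1) unfolding stieltjes_moment_seq_def by auto
  have int: "has_bochner_integral M
      (\<lambda>x. (a n)\<^sup>2 * x ^ (n + 2) - 2 * a n * a (n + 1) * x ^ (n + 1) + (a (n + 1))\<^sup>2 * x ^ n)
      ((a n)\<^sup>2 * a (n + 2) - 2 * a n * a (n + 1) * a (n + 1) + (a (n + 1))\<^sup>2 * a n)"
    by (intro has_bochner_integral_add has_bochner_integral_diff has_bochner_integral_mult_right mom)
  have sq: "(a n)\<^sup>2 * x ^ (n + 2) - 2 * a n * a (n + 1) * x ^ (n + 1) + (a (n + 1))\<^sup>2 * x ^ n
      = x ^ n * (a n * x - a (n + 1))\<^sup>2" for x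
    by (simp add: algebra_simps power2_eq_square)
  have "(a n)\<^sup>2 * a (n + 2) - 2 * a n * a (n + 1) * a (n + 1) + (a (n + 1))\<^sup>2 * a n \<ge> 0"
    by (rule has_bochner_integral_nonneg_halfline[OF M int]) (simp only: sq, simp)
  also have "(a n)\<^sup>2 * a (n + 2) - 2 * a n * a (n + 1) * a (n + 1) + (a (n + 1))\<^sup>2 * a n
      = a n * (a n * a (n + 2) - (a (n + 1))\<^sup>2)"
    by (simp add: algebra_simps power2_eq_square)
  finally show ?thesis
    using assms(2) by (simp add: zero_le_mult_iff)
qed

text \<open>
  Testing the measure against \<open>x * (x - A) ^ (2 * N)\<close> with \<open>A = b + 2 * sqrt c\<close>, the right end
  of the support, concentrates the weight near the left end \<open>b - 2 * sqrt c\<close> as \<open>N\<close> grows.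
\<close>
lemma stieltjes_moment_seq_central_trinomial_imp:
  assumes "c > 0" "stieltjes_moment_seq (central_trinomial b c)"
  shows "b \<ge> 2 * sqrt c"
proof -
  define r where "r = 2 * sqrt c"
  \<comment> \<open>Shifting by \<open>A\<close> replaces \<open>b\<close> by \<open>- r\<close>,
    where the discriminant is zero and the recurrence has only two terms.\<close>
  define A where "A = b + r"
  define T where "T = central_trinomial (- r) c"
  have r: "r > 0" and r2: "(- r)\<^sup>2 = 4 * c"
    using assms(1) by (auto simp: r_def power_mult_distrib)
  have rec: "real (n + 1) * T (n + 1) = - real (2 * n + 1) * r * T n" for n
    using central_trinomial_zero_discriminant[OF r2, of n] by (simp add: T_def algebra_simps)
  have sgn: "(- 1) ^ n * T n > 0" for n
  proof (induction n)
    case 0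
    then show ?case by (simp add: T_def)
  next
    case (Suc n)
    have "real (n + 1) * ((- 1) ^ Suc n * T (Suc n)) = real (2 * n + 1) * r * ((- 1) ^ n * T n)"
    proof -
      have "real (n + 1) * ((- 1) ^ Suc n * T (Suc n)) = (- 1) ^ Suc n * (real (n + 1) * T (n + 1))"
        by simp
      also have "\<dots> = real (2 * n + 1) * r * ((- 1) ^ n * T n)"
        unfolding rec by (simp add: algebra_simps)
      finally show ?thesis .
    qed
    moreover have "real (2 * n + 1) * r * ((- 1) ^ n * T n) > 0"
      using r by (intro mult_pos_pos[OF _ Suc.IH]) auto
    ultimately have "0 < real (n + 1) * ((- 1) ^ Suc n * T (Suc n))"
      by (simp only:)
    then show ?case
      by (rule zero_less_mult_pos) simp
  qed
  obtain M :: "real measure" where M: "sets M = sets (restrict_space borel {0..})"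
    and mom: "\<And>k. has_bochner_integral M (\<lambda>x. x ^ k) (central_trinomial b c k)"
    using assms(2) unfolding stieltjes_moment_seq_def by auto
  have shifted: "has_bochner_integral M (\<lambda>x. (x - A) ^ n) (T n)" for n
    using has_bochner_integral_shifted_moment[OF mom, of "- A" n]
    by (simp add: T_def A_def algebra_simps)
  have ineq: "real (4 * N + 1) * r \<le> real (2 * N + 1) * A" for N
  proof -
    have int: "has_bochner_integral M (\<lambda>x. (x - A) ^ (2 * N + 1) + A * (x - A) ^ (2 * N))
      (T (2 * N + 1) + A * T (2 * N))"
      by (intro has_bochner_integral_add has_bochner_integral_mult_right shifted)
    have sq: "(x - A) ^ (2 * N + 1) + A * (x - A) ^ (2 * N) = x * (x - A) ^ (2 * N)" for x
      by (simp add: algebra_simps)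
    have "T (2 * N + 1) + A * T (2 * N) \<ge> 0"
      by (rule has_bochner_integral_nonneg_halfline[OF M int]) (simp only: sq, simp)
    then have "0 \<le> real (2 * N + 1) * (T (2 * N + 1) + A * T (2 * N))"
      by simp
    also have "\<dots> = (real (2 * N + 1) * A - real (4 * N + 1) * r) * T (2 * N)"
      using rec[of "2 * N"] by (simp add: algebra_simps)
    finally show ?thesis
      using sgn[of "2 * N"] by (simp add: zero_le_mult_iff)
  qed
  \<comment> \<open>\<open>ineq\<close> rearranges to
    \<open>2 * N * (2 * r - A) \<le> A - r\<close>, whose right side does not depend on
    \<open>N\<close>.\<close>
  have "2 * r \<le> A"
  proof (rule ccontr)
    assume "\<not> 2 * r \<le> A"
    then obtain N :: nat where "r < real N * (2 * r - A)"
      using reals_Archimedean3[of "2 * r - A"] by auto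
    with ineq[of N] \<open>\<not> 2 * r \<le> A\<close> r show False
      by (simp add: algebra_simps)
  qed
  then show ?thesis
    by (simp add: A_def r_def)
qed

section \<open>Log-convexity\<close>

text \<open>The adjacent inequalities say that consecutive ratios increase, which then compares any
  two of them.\<close>

lemma log_convex_seqI:
  assumes pos: "\<And>n. a n > 0" and turan: "\<And>n. (a (n + 1))\<^sup>2 \<le> a n * a (n + 2)"
  shows "log_convex_seq a"
proof -
  have "incseq (\<lambda>n. a (n + 1) / a n)"
  proof (rule incseq_SucI)
    show "a (n + 1) / a n \<le> a (Suc n + 1) / a (Suc n)" for n
      using turan[of n] pos[of n] pos[of "Suc n"] by (simp add: field_simps power2_eq_square)
  qed
  then have ratio: "a (i + 1) / a i \<le> a (j + 1) / a j" if "i < j" for i j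
    using incseqD[of "\<lambda>n. a (n + 1) / a n" i j] that by simp
  have "a (i + 1) * a j \<le> a i * a (j + 1)" if "i < j" for i j
    using ratio[OF that] pos[of i] pos[of j] by (simp add: field_simps)
  then show ?thesis
    using pos by (auto simp: log_convex_seq_def intro: less_imp_le)
qed

section \<open>Fixed points of the ratio recurrence\<close>

text \<open>
  The positive fixed point of \<open>x \<mapsto> (2 * n + 1 + n * e / x) / (n + 1)\<close>. For \<open>e = 4 * c - 1\<close>
  this map sends \<open>T n / T (n - 1)\<close> to \<open>T (n + 1) / T n\<close>, where \<open>T = central_trinomial 1 c\<close>.
\<close>
definition ratio_fixpoint :: "real \<Rightarrow> nat \<Rightarrow> real" where
  "ratio_fixpoint e n =
    (2 * real n + 1 + sqrt ((2 * real n + 1)\<^sup>2 + 4 * real n * (real n + 1) * e)) / (2 * (real n + 1))"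

text \<open>Completing the square puts \<open>x\<close> below the larger root of the
  quadratic.\<close>

lemma le_ratio_fixpoint:
  assumes "(real n + 1) * x\<^sup>2 \<le> (2 * real n + 1) * x + real n * e"
  shows "x \<le> ratio_fixpoint e n"
proof -
  have "(2 * (real n + 1) * x - (2 * real n + 1))\<^sup>2
    = (2 * real n + 1)\<^sup>2 + 4 * (real n + 1) * ((real n + 1) * x\<^sup>2 - (2 * real n + 1) * x)"
    by (simp add: algebra_simps power2_eq_square)
  also have "\<dots> \<le> (2 * real n + 1)\<^sup>2 + 4 * (real n + 1) * (real n * e)"
    using assms by (intro add_left_mono mult_left_mono) auto
  finally have "2 * (real n + 1) * x - (2 * real n + 1)
      \<le> sqrt ((2 * real n + 1)\<^sup>2 + 4 * real n * (real n + 1) * e)"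
    by (intro real_le_rsqrt) (simp add: algebra_simps)
  then show ?thesis
    by (simp add: ratio_fixpoint_def field_simps)
qed

lemma ratio_fixpoint:
  assumes "e \<ge> 0"
  shows "(real n + 1) * (ratio_fixpoint e n)\<^sup>2 = (2 * real n + 1) * ratio_fixpoint e n + real n * e"
proof -
  define s where "s = sqrt ((2 * real n + 1)\<^sup>2 + 4 * real n * (real n + 1) * e)"
  define y where "y = ratio_fixpoint e n"
  have "s\<^sup>2 = (2 * real n + 1)\<^sup>2 + 4 * real n * (real n + 1) * e"
    unfolding s_def using assms by (intro real_sqrt_pow2) simp
  moreover have "s = 2 * (real n + 1) * y - (2 * real n + 1)"
    unfolding y_def ratio_fixpoint_def s_def[symmetric] by simp
  ultimately have "4 * (real n + 1) * ((real n + 1) * y\<^sup>2) = 4 * (real n + 1) * ((2 * real n + 1) * y + real n * e)"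
    by (simp add: algebra_simps power2_eq_square)
  then show ?thesis
    unfolding y_def[symmetric] by (simp add: mult_left_cancel)
qed

text \<open>The value 3/2 is attained at \<open>n = 1\<close>, \<open>e = 0\<close>; 5/2 is a
  rational bound above \<open>1 + sqrt 2\<close>, the limit for \<open>e = 1\<close> as
  \<open>n\<close> grows.\<close>

lemma ratio_fixpoint_bounds:
  assumes "0 \<le> e" "e \<le> 1" "n \<ge> 1"
  shows "3 / 2 \<le> ratio_fixpoint e n" "ratio_fixpoint e n \<le> 5 / 2"
proof -
  show "3 / 2 \<le> ratio_fixpoint e n"
    by (rule le_ratio_fixpoint) (use assms in \<open>simp add: field_simps power2_eq_square add_increasing2\<close>)
  define y where "y = ratio_fixpoint e n"
  have fp: "(real n + 1) * y\<^sup>2 = (2 * real n + 1) * y + real n * e"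
    unfolding y_def by (rule ratio_fixpoint[OF assms(1)])
  have "y \<le> 5 / 2"
  proof (rule ccontr)
    assume "\<not> y \<le> 5 / 2"
    then have y: "y > 5 / 2" by simp
    have "(real n + 1) * y\<^sup>2 \<le> (2 * real n + 1) * y + real n"
      using fp assms by (simp add: mult_left_le)
    moreover have "(real n + 1) * (5 / 2 * y) \<le> (real n + 1) * y\<^sup>2"
      using y by (intro mult_left_mono) (auto simp: power2_eq_square)
    moreover have "real n * (5 / 2) \<le> real n * y"
      using y by (intro mult_left_mono) auto
    ultimately show False
      using y by (simp add: algebra_simps)
  qed
  then show "ratio_fixpoint e n \<le> 5 / 2" by (simp add: y_def)
qed

text \<open>Supplies the upper bound in the interlacing induction: step \<open>n + 1\<close> sends
  the fixed point of step \<open>n\<close> below that of step \<open>n + 2\<close>.\<close>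

lemma ratio_fixpoint_step:
  assumes "0 \<le> e" "e \<le> 1" "n \<ge> 1"
  shows "(2 * real n + 3 + (real n + 1) * e / ratio_fixpoint e n) / (real n + 2) \<le> ratio_fixpoint e (n + 2)"
    (is "?g \<le> _")
proof (rule le_ratio_fixpoint)
  define y where "y = ratio_fixpoint e n"
  define m where "m = real n"
  have m: "m \<ge> 1" using assms by (simp add: m_def)
  have y: "3 / 2 \<le> y" "y \<le> 5 / 2"
    using ratio_fixpoint_bounds[OF assms] by (simp_all add: y_def)
  have fp: "m * e = y * ((m + 1) * y - (2 * m + 1))"
    using ratio_fixpoint[OF assms(1), of n] by (simp add: y_def m_def algebra_simps power2_eq_square)
  have "m * e / y = (m + 1) * y - (2 * m + 1)"
    using y by (simp add: fp)
  define w where "w = ?g"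
  have w: "w * (m * (m + 2)) = (m + 1)\<^sup>2 * y - 1"
  proof -
    have "w * (m * (m + 2)) = m * (2 * m + 3 + (m + 1) * e / y)"
      using m unfolding w_def y_def[symmetric] m_def[symmetric] by simp
    also have "\<dots> = m * (2 * m + 3) + (m + 1) * (m * e / y)"
      by (simp add: algebra_simps)
    also have "\<dots> = (m + 1)\<^sup>2 * y - 1"
      unfolding \<open>m * e / y = _\<close> by (simp add: algebra_simps power2_eq_square)
    finally show ?thesis .
  qed
  \<comment> \<open>The claim, after clearing denominators and eliminating \<open>e\<close>, is that a quadratic
    polynomial, convex in \<open>y\<close>, is nonpositive; so it suffices to bound it by its chord
    on \<open>[3/2, 5/2]\<close>.\<close>
  define F where "F = (2 * m\<^sup>2 + 5 * m + 3) * y\<^sup>2 - (2 * m ^ 3 + 11 * m\<^sup>2 + 16 * m + 6) * y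
    + (2 * m ^ 3 + 9 * m\<^sup>2 + 11 * m + 3)"
  have m2: "m\<^sup>2 \<ge> m" and m3: "m ^ 3 \<ge> 1"
    using m by (simp_all add: power2_eq_square)
  have "(y - 3 / 2) * (y - 5 / 2) \<le> 0"
    using y by (intro mult_nonneg_nonpos) auto
  from mult_nonneg_nonpos[OF _ this] have "(2 * m\<^sup>2 + 5 * m + 3) * ((y - 3 / 2) * (y - 5 / 2)) \<le> 0"
    using m by simp
  \<comment> \<open>The two cubics in \<open>m\<close> are the values of \<open>- F\<close> at
    \<open>y = 5 / 2\<close> and \<open>y = 3 / 2\<close>.\<close>
  moreover have "(y - 3 / 2) * (3 * m ^ 3 + 6 * m\<^sup>2 - 9 / 4 * m - 27 / 4) \<ge> 0"
    using y m m2 m3 by (intro mult_nonneg_nonneg; linarith)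
  moreover have "(5 / 2 - y) * (m ^ 3 + 3 * m\<^sup>2 + 7 / 4 * m - 3 / 4) \<ge> 0"
    using y m m2 m3 by (intro mult_nonneg_nonneg; linarith)
  moreover have "F = (2 * m\<^sup>2 + 5 * m + 3) * ((y - 3 / 2) * (y - 5 / 2))
      - (y - 3 / 2) * (3 * m ^ 3 + 6 * m\<^sup>2 - 9 / 4 * m - 27 / 4)
      - (5 / 2 - y) * (m ^ 3 + 3 * m\<^sup>2 + 7 / 4 * m - 3 / 4)"
    by (simp add: F_def field_simps power2_eq_square power3_eq_cube)
  ultimately have "F \<le> 0"
    by linarith
  \<comment> \<open>\<open>G \<le> 0\<close> is the hypothesis of \<open>le_ratio_fixpoint\<close>
    for \<open>n + 2\<close> at \<open>w\<close>; clearing denominators turns \<open>G\<close> into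
    \<open>F\<close>.\<close>
  define G where "G = (m + 3) * w\<^sup>2 - (2 * m + 5) * w - (m + 2) * e"
  have "(m * (m + 2))\<^sup>2 * G = (m + 3) * (w * (m * (m + 2)))\<^sup>2
     - (2 * m + 5) * (m * (m + 2)) * (w * (m * (m + 2))) - m * (m + 2) ^ 3 * (m * e)"
    by (simp add: G_def algebra_simps power2_eq_square power3_eq_cube)
  also have "\<dots> = F"
    unfolding w fp F_def by (simp add: algebra_simps power2_eq_square power3_eq_cube)
  finally have "(m * (m + 2))\<^sup>2 * G \<le> 0"
    using \<open>F \<le> 0\<close> by simp
  then have "G \<le> 0"
    using m by (simp add: mult_le_0_iff)
  then show "(real (n + 2) + 1) * ?g\<^sup>2 \<le> (2 * real (n + 2) + 1) * ?g + real (n + 2) * e"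
    unfolding w_def[symmetric]
    by (simp add: G_def m_def algebra_simps)
qed

text \<open>
  The interlacing is inductive because the recurrence is antitone in \<open>x n\<close>: the upper bound
  \<open>ratio_fixpoint e (n + 1)\<close> is mapped to itself and becomes the next lower bound.
\<close>
lemma ratio_recurrence_bounds:
  fixes x :: "nat \<Rightarrow> real"
  assumes e: "0 \<le> e" "e \<le> 1" and x1: "x 1 = 1"
    and rec: "\<And>n. n \<ge> 1 \<Longrightarrow> x (n + 1) = (2 * real n + 1 + real n * e / x n) / (real n + 1)"
    and "n \<ge> 1"
  shows "ratio_fixpoint e n \<le> x (n + 1) \<and> x (n + 1) \<le> ratio_fixpoint e (n + 1)"
  using \<open>n \<ge> 1\<close>
proof (induction n rule: nat_induct_at_least)
  case base
  have x2: "x (1 + 1) = (3 + e) / 2"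
    using rec[of 1] x1 by simp
  \<comment> \<open>From \<open>y * (2 * y - 3) = e\<close> and \<open>y \<ge> 1\<close> follows
    \<open>2 * y - 3 \<le> e\<close>.\<close>
  have "ratio_fixpoint e 1 \<le> (3 + e) / 2"
  proof -
    define y where "y = ratio_fixpoint e 1"
    have "y \<ge> 3 / 2" using ratio_fixpoint_bounds[of e 1] e by (simp add: y_def)
    have "2 * y\<^sup>2 = 3 * y + e" using ratio_fixpoint[of e 1] e by (simp add: y_def)
    then have "y * (2 * y - 3) = e" by (simp add: algebra_simps power2_eq_square)
    moreover have "1 * (2 * y - 3) \<le> y * (2 * y - 3)"
      using \<open>y \<ge> 3 / 2\<close> by (intro mult_right_mono) auto
    ultimately show ?thesis unfolding y_def by simp
  qed
  moreover have "(3 + e) / 2 \<le> ratio_fixpoint e (1 + 1)"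
  proof (rule le_ratio_fixpoint)
    show "(real (1 + 1) + 1) * ((3 + e) / 2)\<^sup>2
      \<le> (2 * real (1 + 1) + 1) * ((3 + e) / 2) + real (1 + 1) * e"
      using e mult_left_le[of e e] by (simp add: power2_eq_square field_simps)
  qed
  ultimately show ?case
    unfolding x2 by blast
next
  case (Suc n)
  define y where "y = ratio_fixpoint e n"
  define z where "z = ratio_fixpoint e (n + 1)"
  have y: "y \<ge> 3 / 2" and z: "z \<ge> 3 / 2"
    using ratio_fixpoint_bounds[of e] e Suc.hyps by (auto simp: y_def z_def)
  have x: "y \<le> x (n + 1)" "x (n + 1) \<le> z"
    using Suc.IH by (auto simp: y_def z_def)
  have rec': "x (n + 2) = (2 * real n + 3 + (real n + 1) * e / x (n + 1)) / (real n + 2)"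
    using rec[of "n + 1"] by (simp add: algebra_simps)
  have "(real n + 2) * z\<^sup>2 = (2 * real n + 3) * z + (real n + 1) * e"
    using ratio_fixpoint[of e "n + 1"] e by (simp add: z_def algebra_simps)
  moreover have "(p + q / z) * z = p * z + q" for p q
    using z by (simp add: distrib_right)
  ultimately have "(2 * real n + 3 + (real n + 1) * e / z) * z = (real n + 2) * z * z"
    by (simp only: power2_eq_square mult.assoc)
  then have "z = (2 * real n + 3 + (real n + 1) * e / z) / (real n + 2)"
    using z by (simp add: eq_divide_eq mult.commute)
  also have "\<dots> \<le> x (n + 2)"
    unfolding rec' using x y e by (intro divide_right_mono add_left_mono divide_left_mono) auto
  finally have "z \<le> x (n + 2)" .
  moreover have "x (n + 2) \<le> (2 * real n + 3 + (real n + 1) * e / y) / (real n + 2)"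
    unfolding rec' using x y e by (intro divide_right_mono add_left_mono divide_left_mono) auto
  then have "x (n + 2) \<le> ratio_fixpoint e (n + 2)"
    using ratio_fixpoint_step[OF e Suc.hyps] by (simp add: y_def)
  ultimately show ?case
    by (simp add: z_def)
qed

text \<open>Beyond the first step, \<open>ratio_fixpoint e n\<close> lies between \<open>x n\<close>
  and \<open>x (n + 1)\<close>.\<close>

lemma ratio_recurrence_incseq:
  fixes x :: "nat \<Rightarrow> real"
  assumes e: "0 \<le> e" "e \<le> 1" and x1: "x 1 = 1"
    and rec: "\<And>n. n \<ge> 1 \<Longrightarrow> x (n + 1) = (2 * real n + 1 + real n * e / x n) / (real n + 1)"
    and "n \<ge> 1"
  shows "x n \<le> x (n + 1)"
proof (cases "n = 1")
  case True
  then show ?thesis using rec[of 1] x1 e by simp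
next
  case False
  with \<open>n \<ge> 1\<close> obtain k where k: "n = k + 1" "k \<ge> 1"
    by (intro that[of "n - 1"]) auto
  show ?thesis
    using ratio_recurrence_bounds[OF e x1 rec, of k] ratio_recurrence_bounds[OF e x1 rec, of "k + 1"] k
    by auto
qed

section \<open>Log-convexity of central trinomial coefficients\<close>

lemma central_trinomial_turan:
  assumes "b > 0" "c > 0" "2 * c \<le> b\<^sup>2"
  shows "(central_trinomial b c (n + 1))\<^sup>2 \<le> central_trinomial b c n * central_trinomial b c (n + 2)"
proof (cases "4 * c \<le> b\<^sup>2")
  case True
  then have "sqrt (4 * c) \<le> b"
    using assms by (intro real_le_lsqrt) auto
  then have "2 * sqrt c \<le> b"
    by (simp add: real_sqrt_mult)
  then show ?thesis
    using assms by (intro stieltjes_moment_seq_turan stieltjes_moment_seq_central_trinomial central_trinomial_pos) auto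
next
  case False
  define T where "T = central_trinomial b c"
  \<comment> \<open>Scaling by \<open>b\<close> reduces to parameters 1 and
    \<open>c / b\<^sup>2\<close>; \<open>e \<le> 1\<close> is exactly
    \<open>2 * c \<le> b\<^sup>2\<close>.\<close>
  define e where "e = (4 * c - b\<^sup>2) / b\<^sup>2"
  define x where "x n = T n / (b * T (n - 1))" for n
  have pos: "T n > 0" for n
    using assms by (simp add: T_def central_trinomial_pos)
  have e: "0 \<le> e" "e \<le> 1"
    using False assms by (auto simp: e_def field_simps)
  have x1: "x 1 = 1"
    using assms by (simp add: x_def T_def central_trinomial_1)
  have rec: "x (n + 1) = (2 * real n + 1 + real n * e / x n) / (real n + 1)" if n: "n \<ge> 1" for n
  proof -
    obtain k where k: "n = Suc k" using n by (cases n) auto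
    have "real (n + 1) * T (n + 1) = (2 * real n + 1) * b * T n + real n * (4 * c - b\<^sup>2) * T (n - 1)"
      using central_trinomial_recurrence[of k b c] by (simp add: T_def k algebra_simps)
    also have "4 * c - b\<^sup>2 = e * b\<^sup>2"
      using assms by (simp add: e_def)
    finally have eq: "real (n + 1) * T (n + 1) = (2 * real n + 1) * b * T n + real n * (e * b\<^sup>2) * T (n - 1)" .
    have "T (n + 1) / (b * T n) =
        ((2 * real n + 1) * b * T n + real n * (e * b\<^sup>2) * T (n - 1)) / ((real n + 1) * (b * T n))"
      unfolding eq[symmetric] by (simp add: add.commute)
    also have "\<dots> = (2 * real n + 1 + real n * e / (T n / (b * T (n - 1)))) / (real n + 1)"
      using pos[of n] pos[of "n - 1"] assms(1)
      by (simp add: add_divide_distrib power2_eq_square mult.commute)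
    finally show ?thesis
      by (simp add: x_def)
  qed
  have "x (n + 1) \<le> x (n + 1 + 1)"
    by (rule ratio_recurrence_incseq[OF e x1 rec]) auto
  then have "b * x (n + 1) \<le> b * x (n + 1 + 1)"
    using assms(1) by simp
  then have "T (n + 1) / T n \<le> T (n + 2) / T (n + 1)"
    using assms(1) by (simp add: x_def)
  then show ?thesis
    using pos[of n] pos[of "n + 1"] unfolding T_def[symmetric] by (simp add: field_simps power2_eq_square)
qed

text \<open>Indices 1 and 2 suffice, as
  \<open>T 1 * T 3 - (T 2)\<^sup>2 = 2 * c * (b\<^sup>2 - 2 * c)\<close>.\<close>

lemma log_convex_seq_central_trinomial_imp:
  assumes "b > 0" "log_convex_seq (central_trinomial b c)" "c > 0"
  shows "2 * c \<le> b\<^sup>2"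
proof -
  have "central_trinomial b c 1 * central_trinomial b c (2 + 1)
      \<ge> central_trinomial b c (1 + 1) * central_trinomial b c 2"
    using assms(2) unfolding log_convex_seq_def by (meson one_less_numeral_iff semiring_norm(76))
  then have "(b\<^sup>2 + 2 * c) * (b\<^sup>2 + 2 * c) \<le> b * (b ^ 3 + 6 * b * c)"
    by (simp add: central_trinomial_1 central_trinomial_2 central_trinomial_3 flip: numeral_2_eq_2)
  then have "0 \<le> 2 * c * (b\<^sup>2 - 2 * c)"
    by (simp add: algebra_simps power2_eq_square power3_eq_cube)
  then show ?thesis
    using assms(3) by (simp add: zero_le_mult_iff)
qed

theorem theorem3p8:
  fixes b c :: real
  assumes "b > 0" and "c > 0"
  shows "(log_convex_seq (central_trinomial b c) \<longleftrightarrow> b\<^sup>2 \<ge> 2 * c) \<and>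
         (stieltjes_moment_seq (central_trinomial b c) \<longleftrightarrow> b\<^sup>2 \<ge> 4 * c)"
proof -
  have "b\<^sup>2 \<ge> 4 * c \<longleftrightarrow> b \<ge> 2 * sqrt c"
    using real_sqrt_le_iff[of "4 * c" "b\<^sup>2"] assms by (simp add: real_sqrt_mult)
  then show ?thesis
    using assms log_convex_seqI[of "central_trinomial b c"] central_trinomial_pos central_trinomial_turan
      log_convex_seq_central_trinomial_imp stieltjes_moment_seq_central_trinomial
      stieltjes_moment_seq_central_trinomial_imp
    by (metis less_imp_le)
qed

end
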